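(* Let $n\ge3$ and $k\ge3$ be integers. For every $\lambda$ and all $\alpha,\beta,\gamma$ with $\lambda=1+\cos\alpha=\frac23(1+\cos\beta)=\frac23(2+\cos\gamma)$ and $\sin\beta\ne0$, $\sin\gamma\ne0$, $$\det\big(\lambda I_{2(n+k)}-\mathcal{L}(R_{n,k})\big)=p_{n,k}(\lambda)\,q_{n,k}(\lambda),$$ where $p_{n,k}(\lambda)=\frac{1}{2^n3^k\sin\beta}\big(g_k(\beta)\cos(n\alpha)-g_{k-1}(\beta)\cos((n-1)\alpha)\big)$, $q_{n,k}(\lambda)=\frac{1}{2^n3^k\sin\gamma}\big(h_k(\gamma)\cos(n\alpha)-h_{k-1}(\gamma)\cos((n-1)\alpha)\big)$, $g_j(x)=2\sin((j+1)x)+\sin(jx)-\sin((j-1)x)$ and $h_j(x)=2\sin((j+1)x)-\sin(jx)-\sin((j-1)x)$.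
   Context: $R_{n,k}$ ($n\ge1,k\ge2$) is the unweighted graph on vertices $x_1,\dots,x_{n+k},y_1,\dots,y_{n+k}$ with edges $x_ix_{i+1}$ and $y_iy_{i+1}$ for $1\le i\le n+k-1$, and $x_iy_i$ for $n+1\le i\le n+k$. For a graph with adjacency matrix $A$ and degree matrix $D$, the normalized Laplacian is $\mathcal{L}=I-D^{-1/2}AD^{-1/2}$. *)

theory Defs
  imports Complex_Main "Jordan_Normal_Form.Determinant"
begin

text \<open>
  A finite simple graph is given by a distinct list \<open>vs\<close> of all its vertices, which fixes the
  order of rows and columns of its matrices, and the set \<open>E\<close> of its edges, each edge being the
  two-element set of its endpoints.
\<close>

definition vertex_degree :: "'a set set \<Rightarrow> 'a \<Rightarrow> nat" where
  "vertex_degree E v = card {e \<in> E. v \<in> e}"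

definition adjacency_matrix :: "'a list \<Rightarrow> 'a set set \<Rightarrow> real mat" where
  "adjacency_matrix vs E =
     mat (length vs) (length vs) (\<lambda>(i, j). if {vs ! i, vs ! j} \<in> E then 1 else 0)"

definition degree_matrix :: "'a list \<Rightarrow> 'a set set \<Rightarrow> real mat" where
  "degree_matrix vs E =
     mat (length vs) (length vs) (\<lambda>(i, j). if i = j then real (vertex_degree E (vs ! i)) else 0)"

text \<open>
  The power \<open>D\<^sup>-\<^sup>1\<^sup>/\<^sup>2\<close> of a diagonal matrix \<open>D\<close> with nonnegative diagonal entries. A zero
  diagonal entry (an isolated vertex) is sent to \<open>0\<close>, as \<open>1 / 0 = 0\<close>.
\<close>

definition diag_inv_sqrt :: "real mat \<Rightarrow> real mat" where
  "diag_inv_sqrt D =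
     mat (dim_row D) (dim_col D) (\<lambda>(i, j). if i = j then 1 / sqrt (D $$ (i, i)) else 0)"

definition normalized_laplacian :: "'a list \<Rightarrow> 'a set set \<Rightarrow> real mat" where
  "normalized_laplacian vs E =
     1\<^sub>m (length vs) -
     diag_inv_sqrt (degree_matrix vs E) * adjacency_matrix vs E * diag_inv_sqrt (degree_matrix vs E)"

datatype vertex = X nat | Y nat

definition R_vertices :: "nat \<Rightarrow> nat \<Rightarrow> vertex list" where
  "R_vertices n k = map X [1..<n + k + 1] @ map Y [1..<n + k + 1]"

definition R_edges :: "nat \<Rightarrow> nat \<Rightarrow> vertex set set" where
  "R_edges n k =
     {{X i, X (i + 1)} | i. 1 \<le> i \<and> i \<le> n + k - 1} \<union>
     {{Y i, Y (i + 1)} | i. 1 \<le> i \<and> i \<le> n + k - 1} \<union>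
     {{X i, Y i} | i. n + 1 \<le> i \<and> i \<le> n + k}"

definition laplacian_R :: "nat \<Rightarrow> nat \<Rightarrow> complex mat" where
  "laplacian_R n k =
     map_mat complex_of_real (normalized_laplacian (R_vertices n k) (R_edges n k))"

definition g_R :: "nat \<Rightarrow> complex \<Rightarrow> complex" where
  "g_R j x = 2 * sin ((of_nat j + 1) * x) + sin (of_nat j * x) - sin ((of_nat j - 1) * x)"

definition h_R :: "nat \<Rightarrow> complex \<Rightarrow> complex" where
  "h_R j x = 2 * sin ((of_nat j + 1) * x) - sin (of_nat j * x) - sin ((of_nat j - 1) * x)"

text \<open>
  The two factors depend on the spectral parameter only through the angles \<open>\<alpha>\<close>, \<open>\<beta>\<close>, \<open>\<gamma>\<close>
  that parametrize it, so they take these angles as arguments.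
\<close>

definition p_R :: "nat \<Rightarrow> nat \<Rightarrow> complex \<Rightarrow> complex \<Rightarrow> complex" where
  "p_R n k \<alpha> \<beta> =
     1 / (2 ^ n * 3 ^ k * sin \<beta>) *
     (g_R k \<beta> * cos (of_nat n * \<alpha>) - g_R (k - 1) \<beta> * cos ((of_nat n - 1) * \<alpha>))"

definition q_R :: "nat \<Rightarrow> nat \<Rightarrow> complex \<Rightarrow> complex \<Rightarrow> complex" where
  "q_R n k \<alpha> \<gamma> =
     1 / (2 ^ n * 3 ^ k * sin \<gamma>) *
     (h_R k \<gamma> * cos (of_nat n * \<alpha>) - h_R (k - 1) \<gamma> * cos ((of_nat n - 1) * \<alpha>))"

end

theory Submission
  imports Defs
begin

text \<open>
  Reflection \<open>x\<^sub>i \<leftrightarrow> y\<^sub>i\<close> splits \<open>\<lambda>I - \<L>\<close> into a symmetric and an antisymmetric part, both of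
  which are tridiagonal and differ only in the sign of the contribution of the rungs
  \<open>x\<^sub>iy\<^sub>i\<close>. The leading minors of a tridiagonal matrix satisfy a three-term recurrence with
  constant coefficients along the paths (solved by \<open>cos (m\<alpha>) / 2\<^sup>m\<^sup>-\<^sup>1\<close>) and, after rescaling by
  \<open>3\<^sup>-\<^sup>j\<close>, the Chebyshev recurrence of \<open>sin (j\<beta>)\<close> or \<open>sin (j\<gamma>)\<close> along the ladder. The degree
  changes at both ends of the ladder fix the initial values and the last step.
\<close>

subsection \<open>Determinants\<close>

text \<open>Adding the second block row to the first and then subtracting the first block column
  from the second makes the matrix block triangular. Both operations are multiplications by
  unipotent matrices, so no division by 2 occurs.\<close>

lemma det_four_block_mat_symmetric:
  fixes M C :: "'a :: idom mat"
  assumes M: "M \<in> carrier_mat n n" and C: "C \<in> carrier_mat n n"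
  shows "det (four_block_mat M C C M) = det (M + C) * det (M - C)"
proof -
  let ?B = "four_block_mat M C C M"
  let ?P = "four_block_mat (1\<^sub>m n) (1\<^sub>m n) (0\<^sub>m n n) (1\<^sub>m n) :: 'a mat"
  let ?Q = "four_block_mat (1\<^sub>m n) (- 1\<^sub>m n) (0\<^sub>m n n) (1\<^sub>m n) :: 'a mat"
  have B: "?B \<in> carrier_mat (n + n) (n + n)" using M by auto
  have P: "?P \<in> carrier_mat (n + n) (n + n)" and Q: "?Q \<in> carrier_mat (n + n) (n + n)" by auto
  have "?P * ?B = four_block_mat (M + C) (M + C) C M"
    by (subst mult_four_block_mat[of _ n n _ n _ n]) (use M C in \<open>auto simp: comm_add_mat\<close>)
  then have "?P * ?B * ?Q = four_block_mat (M + C) (M + C) C M * ?Q" by simp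
  also have "\<dots> = four_block_mat (M + C) (0\<^sub>m n n) C (M - C)"
    by (subst mult_four_block_mat[of _ n n _ n _ n])
      (use M C in \<open>auto intro!: cong_four_block_mat eq_matI\<close>)
  also have "det \<dots> = det (M + C) * det (M - C)"
    by (rule det_four_block_mat_upper_right_zero) (use M C in auto)
  finally have "det (?P * ?B * ?Q) = det (M + C) * det (M - C)" .
  moreover have "det ?P = 1" "det ?Q = 1"
    by (subst det_four_block_mat_lower_left_zero[of _ n _ n]; auto)+
  moreover have "det (?P * ?B * ?Q) = det ?P * det ?B * det ?Q"
    by (simp add: det_mult[OF mult_carrier_mat[OF P B] Q] det_mult[OF P B])
  ultimately show ?thesis by simp
qed

definition tridiag_mat :: "nat \<Rightarrow> (nat \<Rightarrow> 'a) \<Rightarrow> (nat \<Rightarrow> 'a) \<Rightarrow> 'a :: zero mat" where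
  "tridiag_mat m a b = mat m m (\<lambda>(i, j).
     if i = j then a i else if j = Suc i then b i else if i = Suc j then b j else 0)"

lemma tridiag_mat_carrier [simp]: "tridiag_mat m a b \<in> carrier_mat m m"
  by (simp add: tridiag_mat_def)

lemma det_tridiag_mat_0 [simp]: "det (tridiag_mat 0 a b) = 1"
  by (rule det_dim_zero) simp

lemma det_tridiag_mat_1 [simp]: "det (tridiag_mat (Suc 0) a b) = a 0"
  by (subst det_single[of _]) (auto simp: tridiag_mat_def)

text \<open>Laplace expansion along the last row, which has only two nonzero entries.\<close>

lemma det_tridiag_mat_Suc_Suc:
  fixes a b :: "nat \<Rightarrow> 'a :: comm_ring_1"
  shows "det (tridiag_mat (Suc (Suc m)) a b) =
    a (Suc m) * det (tridiag_mat (Suc m) a b) - (b m)\<^sup>2 * det (tridiag_mat m a b)"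
proof -
  let ?T = "tridiag_mat (Suc (Suc m)) a b"
  let ?B = "mat_delete ?T (Suc m) m"
  have B: "?B \<in> carrier_mat (Suc m) (Suc m)"
    by (auto simp: mat_delete_def tridiag_mat_def)
  \<comment> \<open>The last column of \<open>?B\<close> is the last column of \<open>?T\<close>
    without its bottom entry, so only \<open>b m\<close> survives in it. This second factor
    \<open>b m\<close> produces the square.\<close>
  have "det ?B = (\<Sum>i<Suc m. ?B $$ (i, m) * cofactor ?B i m)"
    by (rule laplace_expansion_column[OF B]) simp
  also have "\<dots> = b m * cofactor ?B m m"
    by (simp, rule trans[OF add.commute], subst sum.neutral)
      (auto simp: mat_delete_def tridiag_mat_def)
  also have "cofactor ?B m m = det (tridiag_mat m a b)"
    unfolding cofactor_def
    by (simp add: mult_2[symmetric] flip: power_add)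
      (rule arg_cong[where f = det], rule eq_matI, auto simp: mat_delete_def tridiag_mat_def)
  finally have minor: "det ?B = b m * det (tridiag_mat m a b)" .
  have "mat_delete ?T (Suc m) (Suc m) = tridiag_mat (Suc m) a b"
    by (rule eq_matI) (auto simp: mat_delete_def tridiag_mat_def)
  then have lead: "cofactor ?T (Suc m) (Suc m) = det (tridiag_mat (Suc m) a b)"
    by (simp add: cofactor_def flip: mult_2)
  have "det ?T = (\<Sum>j<Suc (Suc m). ?T $$ (Suc m, j) * cofactor ?T (Suc m) j)"
    by (rule laplace_expansion_row[OF tridiag_mat_carrier]) simp
  also have "\<dots> = a (Suc m) * cofactor ?T (Suc m) (Suc m) + b m * cofactor ?T (Suc m) m"
    by (simp, subst sum.neutral) (auto simp: tridiag_mat_def)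
  also have "cofactor ?T (Suc m) m = - (b m * det (tridiag_mat m a b))"
    by (simp add: cofactor_def minor flip: mult_2)
  finally show ?thesis by (simp add: lead power2_eq_square algebra_simps)
qed

subsection \<open>The graph\<close>

text \<open>The degree of \<open>x\<^sub>i\<^sub>+\<^sub>1\<close> and of \<open>y\<^sub>i\<^sub>+\<^sub>1\<close>: matrix indices start at \<open>0\<close>, vertex labels at \<open>1\<close>.\<close>

definition ladder_degree :: "nat \<Rightarrow> nat \<Rightarrow> nat \<Rightarrow> nat" where
  "ladder_degree n k i =
     (if i = 0 then 1 else if i < n then 2 else if i < n + k - 1 then 3 else 2)"

text \<open>The possible edges at a vertex are the two along its path and the rung. They are
  distinct, so the degree is a sum of three indicators. At the far end the rung is present and one
  path edge is missing, which gives 2.\<close>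

lemma vertex_degree_X:
  assumes "n \<ge> 1" "k \<ge> 1" "i < n + k"
  shows "vertex_degree (R_edges n k) (X (Suc i)) = ladder_degree n k i"
proof -
  have "{e \<in> R_edges n k. X (Suc i) \<in> e} =
      (if Suc i < n + k then {{X (Suc i), X (Suc (Suc i))}} else {}) \<union>
      (if 0 < i then {{X i, X (Suc i)}} else {}) \<union>
      (if n \<le> i then {{X (Suc i), Y (Suc i)}} else {})"
    using assms by (cases i) (auto simp: R_edges_def)
  then have "vertex_degree (R_edges n k) (X (Suc i)) =
      of_bool (Suc i < n + k) + of_bool (0 < i) + of_bool (n \<le> i)"
    by (simp add: vertex_degree_def doubleton_eq_iff)
  then show ?thesis
    using assms by (simp add: ladder_degree_def less_diff_conv)
qed

lemma vertex_degree_Y: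
  assumes "n \<ge> 1" "k \<ge> 1" "i < n + k"
  shows "vertex_degree (R_edges n k) (Y (Suc i)) = ladder_degree n k i"
proof -
  have "{e \<in> R_edges n k. Y (Suc i) \<in> e} =
      (if Suc i < n + k then {{Y (Suc i), Y (Suc (Suc i))}} else {}) \<union>
      (if 0 < i then {{Y i, Y (Suc i)}} else {}) \<union>
      (if n \<le> i then {{X (Suc i), Y (Suc i)}} else {})"
    using assms by (cases i) (auto simp: R_edges_def)
  then have "vertex_degree (R_edges n k) (Y (Suc i)) =
      of_bool (Suc i < n + k) + of_bool (0 < i) + of_bool (n \<le> i)"
    by (simp add: vertex_degree_def doubleton_eq_iff)
  then show ?thesis
    using assms by (simp add: ladder_degree_def less_diff_conv)
qed

lemma R_edges_adjacent:
  assumes "i < n + k" "j < n + k"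
  shows "{X (Suc i), X (Suc j)} \<in> R_edges n k \<longleftrightarrow> j = Suc i \<or> i = Suc j"
    and "{Y (Suc i), Y (Suc j)} \<in> R_edges n k \<longleftrightarrow> j = Suc i \<or> i = Suc j"
    and "{X (Suc i), Y (Suc j)} \<in> R_edges n k \<longleftrightarrow> i = j \<and> n \<le> i"
    and "{Y (Suc i), X (Suc j)} \<in> R_edges n k \<longleftrightarrow> i = j \<and> n \<le> i"
  using assms by (auto simp: R_edges_def doubleton_eq_iff)

lemma R_edges_no_loop: "{v} \<notin> R_edges n k"
  by (auto simp: R_edges_def)

lemma length_R_vertices [simp]: "length (R_vertices n k) = (n + k) + (n + k)"
  by (simp add: R_vertices_def del: upt_Suc)

lemma nth_R_vertices:
  assumes "i < (n + k) + (n + k)"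
  shows "R_vertices n k ! i = (if i < n + k then X (Suc i) else Y (Suc (i - (n + k))))"
  using assms by (auto simp: R_vertices_def nth_append simp del: upt_Suc)

lemma normalized_laplacian_entry:
  assumes "i < length vs" "j < length vs"
  shows "normalized_laplacian vs E $$ (i, j) = (if i = j then 1 else 0) -
    (if {vs ! i, vs ! j} \<in> E
     then 1 / (sqrt (vertex_degree E (vs ! i)) * sqrt (vertex_degree E (vs ! j))) else 0)"
proof -
  let ?N = "length vs"
  let ?s = "\<lambda>i. 1 / sqrt (vertex_degree E (vs ! i))"
  have S: "diag_inv_sqrt (degree_matrix vs E) = mat_diag ?N ?s"
    by (rule eq_matI) (auto simp: diag_inv_sqrt_def degree_matrix_def mat_diag_def)
  have A: "adjacency_matrix vs E \<in> carrier_mat ?N ?N"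
    by (simp add: adjacency_matrix_def)
  show ?thesis
    using assms unfolding normalized_laplacian_def S mat_diag_mult_left[OF A]
    by (subst mat_diag_mult_right[of _ ?N]) (auto simp: adjacency_matrix_def)
qed

definition path_weight :: "nat \<Rightarrow> nat \<Rightarrow> nat \<Rightarrow> complex" where
  "path_weight n k i =
     complex_of_real (1 / (sqrt (ladder_degree n k i) * sqrt (ladder_degree n k (Suc i))))"

text \<open>The two ends of a rung have equal degree, so the product of their square roots is the
  degree itself.\<close>

definition rung_weight :: "nat \<Rightarrow> nat \<Rightarrow> nat \<Rightarrow> complex" where
  "rung_weight n k i = (if n \<le> i then 1 / of_nat (ladder_degree n k i) else 0)"

text \<open>The tridiagonal recurrence sees only squares of the off-diagonal entries, so all square
  roots disappear.\<close>

lemma path_weight_square: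
  "(path_weight n k i)\<^sup>2 = 1 / (of_nat (ladder_degree n k i) * of_nat (ladder_degree n k (Suc i)))"
  unfolding path_weight_def of_real_power[symmetric] power_divide power_mult_distrib by simp

lemma char_mat_laplacian_R:
  assumes "n \<ge> 1" "k \<ge> 1"
  shows "lam \<cdot>\<^sub>m 1\<^sub>m (2 * (n + k)) - laplacian_R n k =
    four_block_mat (tridiag_mat (n + k) (\<lambda>_. lam - 1) (path_weight n k))
      (mat_diag (n + k) (rung_weight n k)) (mat_diag (n + k) (rung_weight n k))
      (tridiag_mat (n + k) (\<lambda>_. lam - 1) (path_weight n k))"
    (is "?L = ?R")
proof (rule eq_matI)
  let ?vs = "R_vertices n k" and ?E = "R_edges n k"
  have dims: "dim_row (normalized_laplacian ?vs ?E) = (n + k) + (n + k)"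
    "dim_col (normalized_laplacian ?vs ?E) = (n + k) + (n + k)"
    by (auto simp: normalized_laplacian_def diag_inv_sqrt_def degree_matrix_def)
  show "dim_row ?L = dim_row ?R" "dim_col ?L = dim_col ?R"
    by (auto simp: laplacian_R_def dims tridiag_mat_def)
  fix i j assume "i < dim_row ?R" "j < dim_col ?R"
  then have i: "i < (n + k) + (n + k)" and j: "j < (n + k) + (n + k)"
    by (auto simp: tridiag_mat_def)
  \<comment> \<open>Positions within a path: the rows of all x-vertices precede those of the
    y-vertices, so each block is indexed by pairs of such positions.\<close>
  define i' where "i' = (if i < n + k then i else i - (n + k))"
  define j' where "j' = (if j < n + k then j else j - (n + k))"
  have i': "i' < n + k" and j': "j' < n + k" using i j by (auto simp: i'_def j'_def)
  have nth: "?vs ! i = (if i < n + k then X (Suc i') else Y (Suc i'))"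
    "?vs ! j = (if j < n + k then X (Suc j') else Y (Suc j'))"
    using i j by (auto simp: nth_R_vertices i'_def j'_def)
  have deg: "vertex_degree ?E (?vs ! i) = ladder_degree n k i'"
    "vertex_degree ?E (?vs ! j) = ladder_degree n k j'"
    using i' j' assms by (auto simp: nth vertex_degree_X vertex_degree_Y)
  have eq: "i = j \<longleftrightarrow> i' = j' \<and> (i < n + k \<longleftrightarrow> j < n + k)"
    by (auto simp: i'_def j'_def)
  have "?L $$ (i, j) = (if i = j then lam - 1 else 0) +
    (if {?vs ! i, ?vs ! j} \<in> ?E then complex_of_real
      (1 / (sqrt (ladder_degree n k i') * sqrt (ladder_degree n k j'))) else 0)"
    using i j by (auto simp: laplacian_R_def dims normalized_laplacian_entry deg)
  also have "\<dots> = (if (i < n + k \<longleftrightarrow> j < n + k)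
      then tridiag_mat (n + k) (\<lambda>_. lam - 1) (path_weight n k) $$ (i', j')
      else mat_diag (n + k) (rung_weight n k) $$ (i', j'))"
    using i' j' unfolding eq nth
    by (auto simp: R_edges_adjacent R_edges_no_loop tridiag_mat_def mat_diag_def path_weight_def rung_weight_def
        mult.commute simp flip: of_real_mult)
  also have "\<dots> = ?R $$ (i, j)"
    using i j by (auto simp: i'_def j'_def tridiag_mat_def mat_diag_def)
  finally show "?L $$ (i, j) = ?R $$ (i, j)" .
qed

subsection \<open>The two tridiagonal determinants\<close>

text \<open>
  The sign \<open>e\<close> of the rungs is \<open>1\<close> on symmetric and \<open>-1\<close> on antisymmetric vectors.
\<close>

lemma det_ladder_factor:
  fixes e c \<alpha> \<theta> :: complex and n k :: nat
  assumes n: "n \<ge> 2" and k: "k \<ge> 2" and sin: "sin \<theta> \<noteq> 0"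
    and \<alpha>: "c = cos \<alpha>" and \<theta>: "c + e / 3 = 2 / 3 * cos \<theta>"
  shows "det (tridiag_mat (n + k) (\<lambda>i. c + e * rung_weight n k i) (path_weight n k)) =
    1 / (2 ^ n * 3 ^ k * sin \<theta>) *
      ((2 * sin ((of_nat k + 1) * \<theta>) + e * sin (of_nat k * \<theta>) - sin ((of_nat k - 1) * \<theta>))
         * cos (of_nat n * \<alpha>)
       - (2 * sin (of_nat k * \<theta>) + e * sin ((of_nat k - 1) * \<theta>) - sin ((of_nat k - 2) * \<theta>))
         * cos ((of_nat n - 1) * \<alpha>))"
proof -
  define d where "d m = det (tridiag_mat m (\<lambda>i. c + e * rung_weight n k i) (path_weight n k))" for m
  \<comment> \<open>The common denominator makes \<open>d n = A\<close> and
    \<open>d (n - 1) = 2 * B\<close>.\<close>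
  define A where "A = cos (of_nat n * \<alpha>) / 2 ^ (n - 1)"
  define B where "B = cos ((of_nat n - 1) * \<alpha>) / 2 ^ (n - 1)"
  define s where "s i = sin (of_nat i * \<theta>)" for i :: nat
  have rec: "d (Suc (Suc m)) = (c + e * rung_weight n k (Suc m)) * d (Suc m) -
      d m / (of_nat (ladder_degree n k m) * of_nat (ladder_degree n k (Suc m)))" for m
    by (simp add: d_def det_tridiag_mat_Suc_Suc path_weight_square)
  have cos_rec: "cos ((z + 2) * \<alpha>) = 2 * cos \<alpha> * cos ((z + 1) * \<alpha>) - cos (z * \<alpha>)" for z
    using cos_add[of "(z + 1) * \<alpha>" \<alpha>] cos_diff[of "(z + 1) * \<alpha>" \<alpha>]
    by (simp add: algebra_simps)
  have s_rec: "s (Suc (Suc i)) = 2 * cos \<theta> * s (Suc i) - s i" for i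
    using sin_add[of "of_nat (Suc i) * \<theta>" \<theta>] sin_diff[of "of_nat (Suc i) * \<theta>" \<theta>]
    by (simp add: s_def algebra_simps)
  have s_0: "s 0 = 0" and s_1: "s (Suc 0) \<noteq> 0" using sin by (simp_all add: s_def)
  \<comment> \<open>The first edge joins degrees 1 and 2 and contributes 1/2 instead of 1/4; hence
    the second base case, where
    \<open>cos \<alpha> ^ 2 - 1/2 = cos (2 * \<alpha>) / 2\<close>.\<close>
  have path: "m < n \<Longrightarrow> d (Suc m) = cos ((of_nat m + 1) * \<alpha>) / 2 ^ m" for m
  proof (induction m rule: induct_nat_012)
    case 0
    then show ?case by (simp add: d_def rung_weight_def \<alpha>)
  next
    case 1
    then show ?case using n cos_rec[of 0]
      by (simp add: rec) (simp add: d_def rung_weight_def ladder_degree_def \<alpha> field_simps)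
  next
    case (ge2 m)
    then show ?case using cos_rec[of "of_nat m + 1"]
      by (subst rec) (simp add: rung_weight_def ladder_degree_def \<alpha> field_simps)
  qed
  obtain p where p: "n = Suc (Suc p)" using n by (metis add_2_eq_Suc le_Suc_ex)
  have dn: "d n = A" "d (n - 1) = 2 * B"
    using path[of "Suc p"] path[of p] by (auto simp: A_def B_def p add.commute)
  \<comment> \<open>Only minors with j < k are covered: their last vertex still has degree 3 when j
    > 0.\<close>
  have ladder: "j < k \<Longrightarrow> d (n + j) = (A * s (Suc j) - B * s j) / (3 ^ j * s (Suc 0))" for j
  proof (induction j rule: induct_nat_012)
    case 0
    then show ?case using s_1 dn by (simp add: s_0)
  next
    case 1
    \<comment> \<open>The edge entering the ladder joins degrees 2 and 3, so the last term is 2B/6.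
      It equals 3B/9, as if the ladder recurrence had been running with previous value 3B.\<close>
    have "d (Suc n) = (c + e / 3) * A - B / 3"
      using 1 k dn rec[of "n - 1"] by (simp add: p rung_weight_def ladder_degree_def)
    then show ?case using s_1 unfolding \<theta> by (simp add: s_rec s_0 diff_divide_distrib)
  next
    case (ge2 j)
    have "d (n + Suc (Suc j)) = (c + e / 3) * d (n + Suc j) - d (n + j) / 9"
      using ge2.prems n rec[of "n + j"]
      by (simp add: rung_weight_def ladder_degree_def less_diff_conv)
    also have "\<dots> = 2 / 3 * cos \<theta> * ((A * s (Suc (Suc j)) - B * s (Suc j)) / (3 ^ Suc j * s (Suc 0)))
        - (A * s (Suc j) - B * s j) / (3 ^ j * s (Suc 0)) / 9"
      using ge2 unfolding \<theta> by simp
    also have "\<dots> = (2 * cos \<theta> * (A * s (Suc (Suc j)) - B * s (Suc j)) - (A * s (Suc j) - B * s j))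
        / (3 ^ Suc (Suc j) * s (Suc 0))"
      using s_1 by (simp add: divide_simps)
    also have "2 * cos \<theta> * (A * s (Suc (Suc j)) - B * s (Suc j)) - (A * s (Suc j) - B * s j) =
        A * s (Suc (Suc (Suc j))) - B * s (Suc (Suc j))"
      by (simp add: s_rec algebra_simps)
    finally show ?case .
  qed
  obtain q where q: "k = Suc (Suc q)" using k by (metis add_2_eq_Suc le_Suc_ex)
  \<comment> \<open>The last vertex has degree 2 and its predecessor degree 3: the rung contributes
    e/2 and the path edge 1/6.\<close>
  have "d (n + k) = (c + e / 2) * d (n + Suc q) - d (n + q) / 6"
    using n rec[of "n + q"] by (simp add: q rung_weight_def ladder_degree_def)
  also have "c + e / 2 = 2 / 3 * cos \<theta> + e / 6"
    unfolding \<theta>[symmetric] by simp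
  also have "(2 / 3 * cos \<theta> + e / 6) * d (n + Suc q) - d (n + q) / 6 =
      (2 / 3 * cos \<theta> + e / 6) * ((A * s k - B * s (Suc q)) / (3 ^ Suc q * s (Suc 0)))
      - (A * s (Suc q) - B * s q) / (3 ^ q * s (Suc 0)) / 6"
    using ladder[of "Suc q"] ladder[of q] by (simp add: q)
  also have "\<dots> = ((4 * cos \<theta> + e) * (A * s k - B * s (Suc q)) - 3 * (A * s (Suc q) - B * s q))
      / (2 * 3 ^ k * s (Suc 0))"
    using s_1 by (simp add: q divide_simps)
  \<comment> \<open>Here \<open>4 * cos \<theta> * s k\<close> is twice the sum of the neighbouring
    sines. Subtracting three times the lower one leaves the coefficients 2 and -1 seen in
    \<open>g_R\<close> and \<open>h_R\<close>.\<close>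
  also have "(4 * cos \<theta> + e) * (A * s k - B * s (Suc q)) - 3 * (A * s (Suc q) - B * s q) =
      A * (2 * s (Suc k) + e * s k - s (Suc q)) - B * (2 * s k + e * s (Suc q) - s q)"
    by (simp add: q s_rec algebra_simps)
  also have "\<dots> / (2 * 3 ^ k * s (Suc 0)) = 1 / (2 ^ n * 3 ^ k * s (Suc 0)) *
      ((2 * s (Suc k) + e * s k - s (Suc q)) * cos (of_nat n * \<alpha>)
       - (2 * s k + e * s (Suc q) - s q) * cos ((of_nat n - 1) * \<alpha>))"
    using s_1 by (simp add: A_def B_def p divide_simps)
  finally show ?thesis
    unfolding d_def[symmetric] by (simp add: s_def q add.commute)
qed

theorem theorem6:
  fixes n k :: nat and lam \<alpha> \<beta> \<gamma> :: complex
  assumes "n \<ge> 3" and "k \<ge> 3"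
    and "lam = 1 + cos \<alpha>"
    and "lam = 2 / 3 * (1 + cos \<beta>)"
    and "lam = 2 / 3 * (2 + cos \<gamma>)"
    and "sin \<beta> \<noteq> 0" and "sin \<gamma> \<noteq> 0"
  shows "det (lam \<cdot>\<^sub>m 1\<^sub>m (2 * (n + k)) - laplacian_R n k) = p_R n k \<alpha> \<beta> * q_R n k \<alpha> \<gamma>"
proof -
  let ?T = "\<lambda>a. tridiag_mat (n + k) a (path_weight n k)"
  let ?C = "mat_diag (n + k) (rung_weight n k)"
  \<comment> \<open>The diagonal entries of the two tridiagonal matrices: lam - 1 on the tails, and
    lam - 1 plus or minus 1/3 at ladder vertices of degree 3.\<close>
  have \<alpha>: "lam - 1 = cos \<alpha>"
    and \<beta>: "lam - 1 + 1 / 3 = 2 / 3 * cos \<beta>" and \<gamma>: "lam - 1 + - 1 / 3 = 2 / 3 * cos \<gamma>"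
    using assms(3) by (simp, use assms(4,5) in \<open>simp_all add: field_simps\<close>)
  have "det (lam \<cdot>\<^sub>m 1\<^sub>m (2 * (n + k)) - laplacian_R n k) =
      det (?T (\<lambda>_. lam - 1) + ?C) * det (?T (\<lambda>_. lam - 1) - ?C)"
    using assms by (subst char_mat_laplacian_R) (auto intro!: det_four_block_mat_symmetric[of _ "n + k"])
  also have "?T (\<lambda>_. lam - 1) + ?C = ?T (\<lambda>i. lam - 1 + 1 * rung_weight n k i)"
    by (rule eq_matI) (auto simp: tridiag_mat_def mat_diag_def)
  also have "?T (\<lambda>_. lam - 1) - ?C = ?T (\<lambda>i. lam - 1 + - 1 * rung_weight n k i)"
    by (rule eq_matI) (auto simp: tridiag_mat_def mat_diag_def)
  \<comment> \<open>The sign e = 1 turns the sine combination into \<open>g_R\<close>, and e = -1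
    below turns it into \<open>h_R\<close>.\<close>
  also have "det (?T (\<lambda>i. lam - 1 + 1 * rung_weight n k i)) = p_R n k \<alpha> \<beta>"
    using assms by (subst det_ladder_factor[OF _ _ _ \<alpha> \<beta>])
      (auto simp: p_R_def g_R_def of_nat_diff)
  also have "det (?T (\<lambda>i. lam - 1 + - 1 * rung_weight n k i)) = q_R n k \<alpha> \<gamma>"
    using assms by (subst det_ladder_factor[OF _ _ _ \<alpha> \<gamma>])
      (auto simp: q_R_def h_R_def of_nat_diff)
  finally show ?thesis .
qed

end
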